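(* Let $X=X_0\cup X_1\cup\dots\cup X_d$ be a finite set of labels with $X_0=\{x\}$, and let $Y$ be a finite set of labelled trees (patterns). Then the language $L(X|Y)$ of Polish-notation words of labelled trees avoiding $Y$ is a deterministic context-free language.
   Context: Labelled trees: planar rooted trees whose vertices other than the root carry labels from a finite set $X=X_0\cup\dots\cup X_d$ ($d>0$), where $X_i$ is the set of labels of vertices having exactly $i$ children; $X_0=\{x\}$ and vertices labelled $x$ are leaves called free ends. Grafting a tree $s$ onto a free end of a tree $t$ means identifying the root edge of $s$ with that free end. A tree $T$ avoids a set $Y$ of patterns if $T$ cannot be obtained by successively grafting several trees onto each other with at least one of them an element of $Y$; equivalently, $T$ contains no subtree isomorphic (as a labelled planar tree) to an element of $Y$. Each labelled tree is encoded in Polish (prefix) notation as a word over the alphabet $X$: the label of the top vertex followed by the encodings of its children's subtrees from left to right, free ends encoded as $x$. $L(X|Y)$ is the set of such words of all trees avoiding $Y$. *)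

theory Defs
  imports Main "HOL-Library.Disjoint_Sets"
begin

section \<open>Labelled planar rooted trees\<close>

text \<open>The root is an unlabelled vertex with a single edge going out of it, so a tree is
  represented by the labelled vertex at the other end of its root edge. Planar trees up to
  label-preserving isomorphism are then exactly the values of this type.\<close>

datatype 'a ltree = Node 'a "'a ltree list"

inductive_set trees :: "(nat \<Rightarrow> 'a set) \<Rightarrow> nat \<Rightarrow> 'a ltree set"
  for X :: "nat \<Rightarrow> 'a set" and d :: nat where
  "\<lbrakk>length ts \<le> d; a \<in> X (length ts); ts \<in> lists (trees X d)\<rbrakk> \<Longrightarrow> Node a ts \<in> trees X d"

text \<open>\<open>graft x s t T\<close>: the tree \<open>T\<close> is the result of grafting \<open>s\<close> onto one free end
  (a leaf labelled \<open>x\<close>) of \<open>t\<close>.\<close>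

inductive graft :: "'a \<Rightarrow> 'a ltree \<Rightarrow> 'a ltree \<Rightarrow> 'a ltree \<Rightarrow> bool"
  for x :: 'a and s :: "'a ltree" where
  free_end: "graft x s (Node x []) s"
| child: "graft x s t t' \<Longrightarrow> graft x s (Node a (us @ t # vs)) (Node a (us @ t' # vs))"

text \<open>\<open>grafted x ts T\<close>: the tree \<open>T\<close> is obtained by successively grafting the members of
  the list \<open>ts\<close> onto each other.\<close>

inductive grafted :: "'a \<Rightarrow> 'a ltree list \<Rightarrow> 'a ltree \<Rightarrow> bool" for x :: 'a where
  single: "grafted x [t] t"
| graft: "\<lbrakk>grafted x ss s; grafted x ts t; graft x s t T\<rbrakk> \<Longrightarrow> grafted x (ss @ ts) T"

definition avoids :: "(nat \<Rightarrow> 'a set) \<Rightarrow> nat \<Rightarrow> 'a \<Rightarrow> 'a ltree set \<Rightarrow> 'a ltree \<Rightarrow> bool" where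
  "avoids X d x Y T \<longleftrightarrow>
     \<not> (\<exists>ts. ts \<in> lists (trees X d) \<and> set ts \<inter> Y \<noteq> {} \<and> grafted x ts T)"

fun polish :: "'a ltree \<Rightarrow> 'a list" where
  "polish (Node a ts) = a # concat (map polish ts)"

definition avoiding_language ::
    "(nat \<Rightarrow> 'a set) \<Rightarrow> nat \<Rightarrow> 'a \<Rightarrow> 'a ltree set \<Rightarrow> 'a list set" where
  "avoiding_language X d x Y = polish ` {T \<in> trees X d. avoids X d x Y T}"


section \<open>Deterministic context-free languages\<close>

text \<open>In \<open>transition M q c Z\<close> the input \<open>c = None\<close> stands for a move that reads nothing, and a
  result \<open>Some (p, \<beta>)\<close> means: go to state \<open>p\<close> and replace the topmost stack symbol \<open>Z\<close> by
  \<open>\<beta>\<close>. The head of a list is the top of the stack.\<close>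

record ('q, 'a, 'z) pda =
  states :: "'q set"
  input_alphabet :: "'a set"
  stack_alphabet :: "'z set"
  transition :: "'q \<Rightarrow> 'a option \<Rightarrow> 'z \<Rightarrow> ('q \<times> 'z list) option"
  start_state :: 'q
  start_symbol :: 'z
  final_states :: "'q set"

definition dpda :: "('q, 'a, 'z) pda \<Rightarrow> bool" where
  "dpda M \<longleftrightarrow>
     finite (states M) \<and> finite (input_alphabet M) \<and> finite (stack_alphabet M) \<and>
     start_state M \<in> states M \<and> start_symbol M \<in> stack_alphabet M \<and> final_states M \<subseteq> states M \<and>
     (\<forall>q \<in> states M. \<forall>c \<in> insert None (Some ` input_alphabet M). \<forall>Z \<in> stack_alphabet M.
        \<forall>p \<beta>. transition M q c Z = Some (p, \<beta>) \<longrightarrow> p \<in> states M \<and> \<beta> \<in> lists (stack_alphabet M)) \<and>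
     (\<forall>q \<in> states M. \<forall>Z \<in> stack_alphabet M. transition M q None Z \<noteq> None \<longrightarrow>
        (\<forall>a \<in> input_alphabet M. transition M q (Some a) Z = None))"

inductive pda_step :: "('q, 'a, 'z) pda \<Rightarrow> 'q \<times> 'a list \<times> 'z list \<Rightarrow> 'q \<times> 'a list \<times> 'z list \<Rightarrow> bool"
  for M :: "('q, 'a, 'z) pda" where
  read: "transition M q (Some a) Z = Some (p, \<beta>) \<Longrightarrow> pda_step M (q, a # w, Z # \<gamma>) (p, w, \<beta> @ \<gamma>)"
| silent: "transition M q None Z = Some (p, \<beta>) \<Longrightarrow> pda_step M (q, w, Z # \<gamma>) (p, w, \<beta> @ \<gamma>)"

definition accepted_language :: "('q, 'a, 'z) pda \<Rightarrow> 'a list set" where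
  "accepted_language M =
     {w \<in> lists (input_alphabet M).
        \<exists>q \<in> final_states M. \<exists>\<gamma>. (pda_step M)\<^sup>*\<^sup>* (start_state M, w, [start_symbol M]) (q, [], \<gamma>)}"

text \<open>States and stack symbols range over finite sets, so taking them to be natural numbers
  loses no generality.\<close>

definition deterministic_context_free :: "'a set \<Rightarrow> 'a list set \<Rightarrow> bool" where
  "deterministic_context_free A L \<longleftrightarrow>
     (\<exists>M :: (nat, 'a, nat) pda. dpda M \<and> input_alphabet M = A \<and> accepted_language M = L)"


section \<open>Avoidance in terms of subtrees\<close>

text \<open>\<open>matches x p t\<close>: the pattern \<open>p\<close> occurs at the top of \<open>t\<close>.\<close>

inductive matches :: "'a \<Rightarrow> 'a ltree \<Rightarrow> 'a ltree \<Rightarrow> bool" for x :: 'a where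
  free_end: "matches x (Node x []) t"
| node: "list_all2 (matches x) ps ts \<Longrightarrow> matches x (Node a ps) (Node a ts)"
  monos list.rel_mono_strong

inductive occurs :: "'a \<Rightarrow> 'a ltree \<Rightarrow> 'a ltree \<Rightarrow> bool" for x :: 'a and p :: "'a ltree" where
  top: "matches x p t \<Longrightarrow> occurs x p t"
| child: "occurs x p t \<Longrightarrow> t \<in> set ts \<Longrightarrow> occurs x p (Node a ts)"

lemma matches_refl: "matches x t t"
  by (induction t) (auto intro!: matches.node simp: list_all2_same)

lemma matches_graft: "graft x s t T \<Longrightarrow> matches x p t \<Longrightarrow> matches x p T"
proof (induction arbitrary: p rule: graft.induct)
  case free_end
  then show ?case by cases (auto intro: matches.free_end)
next
  case (child t t' a us vs)
  from child.prems show ?case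
  proof cases
    case free_end
    then show ?thesis by (simp add: matches.free_end)
  next
    case (node ps)
    then obtain us' p' vs' where "ps = us' @ p' # vs'" "list_all2 (matches x) us' us"
      "matches x p' t" "list_all2 (matches x) vs' vs"
      by (auto simp: list_all2_append2 list_all2_Cons2)
    then show ?thesis using child.IH node
      by (auto intro!: matches.node list_all2_appendI)
  qed
qed

lemma occurs_graft: "graft x s t T \<Longrightarrow> occurs x p t \<Longrightarrow> occurs x p T"
proof (induction rule: graft.induct)
  case free_end
  from free_end show ?case
    by cases (auto intro: occurs.top matches_graft graft.free_end)
next
  case (child t t' a us vs)
  from child.prems show ?case
  proof cases
    case top
    then show ?thesis using matches_graft[OF graft.child[OF child.hyps]] by (blast intro: occurs.top)
  next
    case (child u)
    then show ?thesis using \<open>occurs x p t \<Longrightarrow> occurs x p t'\<close>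
      by (cases "u = t") (auto intro: occurs.child)
  qed
qed

lemma occurs_grafted_tree: "graft x s t T \<Longrightarrow> occurs x p s \<Longrightarrow> occurs x p T"
  by (induction rule: graft.induct) (auto intro: occurs.child)

lemma grafted_imp_occurs: "grafted x ts T \<Longrightarrow> p \<in> set ts \<Longrightarrow> occurs x p T"
  by (induction rule: grafted.induct)
    (auto intro: occurs.top matches_refl occurs_graft occurs_grafted_tree)

lemma matches_imp_grafts:
  "matches x p t \<Longrightarrow> t \<in> trees X d \<Longrightarrow> (\<lambda>t T. \<exists>s \<in> trees X d. graft x s t T)\<^sup>*\<^sup>* p t"
proof (induction rule: matches.induct)
  case (free_end t)
  then show ?case by (auto intro: graft.free_end)
next
  case (node ps ts a)
  let ?R = "\<lambda>t T. \<exists>s \<in> trees X d. graft x s t T"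
  have ctxt: "?R\<^sup>*\<^sup>* (Node a (us @ t # vs)) (Node a (us @ t' # vs))" if "?R\<^sup>*\<^sup>* t t'" for t t' us vs
    using that
  proof (induction rule: rtranclp_induct)
    case (step y z)
    have "?R (Node a (us @ y # vs)) (Node a (us @ z # vs))"
      using step(2) by (auto intro: graft.child)
    with step(3) show ?case by (rule rtranclp.rtrancl_into_rtrancl)
  qed simp
  have "set ts \<subseteq> trees X d" using node.prems by cases auto
  with node.IH have "?R\<^sup>*\<^sup>* (Node a (us @ ps)) (Node a (us @ ts))" for us
  proof (induction arbitrary: us rule: list_all2_induct)
    case (Cons p ps t ts)
    have "?R\<^sup>*\<^sup>* (Node a (us @ p # ps)) (Node a (us @ t # ps))"
      using Cons.hyps Cons.prems by (intro ctxt) auto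
    also have "?R\<^sup>*\<^sup>* (Node a (us @ t # ps)) (Node a (us @ t # ts))"
      using Cons.IH[of "us @ [t]"] Cons.prems by auto
    finally show ?case .
  qed simp
  from this[of "[]"] show ?case by simp
qed

lemma occurs_imp_grafted:
  assumes "occurs x p T" "T \<in> trees X d" "p \<in> trees X d" "x \<in> X 0"
  shows "\<exists>ts \<in> lists (trees X d). p \<in> set ts \<and> grafted x ts T"
  using assms(1,2)
proof (induction rule: occurs.induct)
  case (top t)
  from matches_imp_grafts[OF this] show ?case
  proof (induction rule: rtranclp_induct)
    case base
    show ?case using assms(3) by (intro bexI[of _ "[p]"]) (auto intro: grafted.single)
  next
    case (step y z)
    then obtain s ts where "s \<in> trees X d" "graft x s y z" "ts \<in> lists (trees X d)"
      "p \<in> set ts" "grafted x ts y" by auto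
    then show ?case
      by (intro bexI[of _ "[s] @ ts"]) (auto intro: grafted.intros simp del: append_Cons append_Nil)
  qed
next
  case (child t ts a)
  from child.prems have a: "length ts \<le> d" "a \<in> X (length ts)" "set ts \<subseteq> trees X d"
    by (cases; auto)+
  from child obtain ss where ss: "ss \<in> lists (trees X d)" "p \<in> set ss" "grafted x ss t"
    using a by blast
  from \<open>t \<in> set ts\<close> obtain us vs where ts: "ts = us @ t # vs" by (auto dest: split_list)
  let ?N = "Node a (us @ Node x [] # vs)"
  have "Node x [] \<in> trees X d" using assms(4) by (auto intro: trees.intros)
  then have "?N \<in> trees X d" using a ts by (auto intro!: trees.intros)
  moreover have "grafted x (ss @ [?N]) (Node a ts)"
    unfolding ts by (rule grafted.graft[OF ss(3) grafted.single]) (intro graft.intros)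
  ultimately show ?case using ss by (intro bexI[of _ "ss @ [?N]"]) auto
qed

lemma avoids_iff_no_occurrence:
  assumes "T \<in> trees X d" "Y \<subseteq> trees X d" "x \<in> X 0"
  shows "avoids X d x Y T \<longleftrightarrow> (\<forall>p \<in> Y. \<not> occurs x p T)"
proof
  assume av: "avoids X d x Y T"
  show "\<forall>p \<in> Y. \<not> occurs x p T"
  proof
    fix p assume p: "p \<in> Y"
    show "\<not> occurs x p T"
    proof
      assume "occurs x p T"
      with occurs_imp_grafted[of x p T X d] p assms obtain ts
        where "ts \<in> lists (trees X d)" "p \<in> set ts" "grafted x ts T" by blast
      with p av show False unfolding avoids_def by blast
    qed
  qed
next
  assume "\<forall>p \<in> Y. \<not> occurs x p T"
  then show "avoids X d x Y T"
    unfolding avoids_def using grafted_imp_occurs by fast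
qed

end

theory Submission
  imports Defs
begin

text \<open>Whether a tree avoids \<open>Y\<close> can be computed bottom-up with finitely many values: for each
  vertex it suffices to know which subtrees of patterns match at that vertex, and whether some
  pattern occurs below it. So the avoiding trees form a regular tree language. A deterministic
  pushdown automaton evaluates a bottom-up tree automaton on Polish notation: the stack holds, for
  every vertex whose subtree has not been read completely, its label and the values of the children
  read so far. Once as many values are present as the arity of the label requires, the frame is
  popped and the value of the vertex is handed to the frame of its parent.\<close>

section \<open>Renaming the states and stack symbols of a pushdown automaton\<close>

text \<open>Configurations are triples; with the tuples split, inductions over runs can generalise
  and name state, input and stack separately.\<close>

lemmas rtranclp_induct3 =
  rtranclp_induct[of _ "(ax, ay, az)" "(bx, by, bz)", split_rule, consumes 1, case_names refl step]

lemmas converse_rtranclp_induct3 =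
  converse_rtranclp_induct[of _ "(ax, ay, az)" "(bx, by, bz)", split_rule, consumes 1,
    case_names refl step]

text \<open>Decoding by \<open>inv_into\<close> is meaningful only on the images of the state set
  and the stack alphabet, where it inverts \<open>f\<close> and \<open>g\<close> once these are
  injective.\<close>

definition rename_pda :: "('q \<Rightarrow> 'p) \<Rightarrow> ('z \<Rightarrow> 'y) \<Rightarrow> ('q, 'a, 'z) pda \<Rightarrow> ('p, 'a, 'y) pda" where
  "rename_pda f g M =
     \<lparr>states = f ` states M, input_alphabet = input_alphabet M, stack_alphabet = g ` stack_alphabet M,
      transition = (\<lambda>p c Z. map_option (map_prod f (map g))
        (transition M (inv_into (states M) f p) c (inv_into (stack_alphabet M) g Z))),
      start_state = f (start_state M), start_symbol = g (start_symbol M),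
      final_states = f ` final_states M\<rparr>"

lemma dpdaD:
  assumes "dpda M"
  shows "finite (states M)" "finite (input_alphabet M)" "finite (stack_alphabet M)"
    "start_state M \<in> states M" "start_symbol M \<in> stack_alphabet M" "final_states M \<subseteq> states M"
  using assms unfolding dpda_def by blast+

lemma dpda_transition_closed:
  assumes "dpda M" "transition M q c Z = Some (p, \<beta>)" "q \<in> states M" "Z \<in> stack_alphabet M"
    "c \<in> insert None (Some ` input_alphabet M)"
  shows "p \<in> states M \<and> \<beta> \<in> lists (stack_alphabet M)"
proof -
  from assms(1) have "\<forall>q \<in> states M. \<forall>c \<in> insert None (Some ` input_alphabet M).
      \<forall>Z \<in> stack_alphabet M. \<forall>p \<beta>. transition M q c Z = Some (p, \<beta>) \<longrightarrow>
        p \<in> states M \<and> \<beta> \<in> lists (stack_alphabet M)"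
    unfolding dpda_def by (elim conjE)
  from this[rule_format, OF assms(3,5,4,2)] show ?thesis .
qed

lemma dpda_deterministic:
  assumes "dpda M" "transition M q None Z \<noteq> None" "q \<in> states M" "Z \<in> stack_alphabet M"
    "a \<in> input_alphabet M"
  shows "transition M q (Some a) Z = None"
proof -
  from assms(1) have "\<forall>q \<in> states M. \<forall>Z \<in> stack_alphabet M. transition M q None Z \<noteq> None \<longrightarrow>
      (\<forall>a \<in> input_alphabet M. transition M q (Some a) Z = None)"
    unfolding dpda_def by (elim conjE)
  with assms(2-) show ?thesis by simp
qed

text \<open>\<open>pda_step\<close> itself does not check membership. This closure keeps runs inside
  the sets on which a renaming is injective.\<close>

lemma dpda_step_closed:
  assumes "dpda M" "pda_step M (q, w, \<gamma>) (q', w', \<gamma>')"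
    "q \<in> states M" "w \<in> lists (input_alphabet M)" "\<gamma> \<in> lists (stack_alphabet M)"
  shows "q' \<in> states M" "w' \<in> lists (input_alphabet M)" "\<gamma>' \<in> lists (stack_alphabet M)"
proof -
  from assms(2) have "q' \<in> states M \<and> w' \<in> lists (input_alphabet M) \<and> \<gamma>' \<in> lists (stack_alphabet M)"
  proof cases
    case (read a Z \<beta> \<gamma>1)
    with assms(3-) dpda_transition_closed[OF assms(1), of q "Some a" Z q' \<beta>] show ?thesis by auto
  next
    case (silent Z \<beta> \<gamma>1)
    with assms(3-) dpda_transition_closed[OF assms(1), of q None Z q' \<beta>] show ?thesis by auto
  qed
  then show "q' \<in> states M" "w' \<in> lists (input_alphabet M)" "\<gamma>' \<in> lists (stack_alphabet M)"
    by blast+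
qed

section \<open>Correspondence between the runs of an automaton and of its renamed copy\<close>

locale renamed_dpda =
  fixes M :: "('q, 'a, 'z) pda" and f :: "'q \<Rightarrow> 'p" and g :: "'z \<Rightarrow> 'y"
  assumes dpda: "dpda M"
    and inj_f: "inj_on f (states M)" and inj_g: "inj_on g (stack_alphabet M)"
begin

abbreviation "M' \<equiv> rename_pda f g M"

lemma transition_renamed:
  assumes "q \<in> states M" "Z \<in> stack_alphabet M"
  shows "transition M' (f q) c (g Z) = map_option (map_prod f (map g)) (transition M q c Z)"
  using assms inj_f inj_g by (simp add: rename_pda_def)

lemma dpda_renamed: "dpda M'"
proof -
  have closed: "p \<in> states M' \<and> \<beta> \<in> lists (stack_alphabet M')"
    if "q \<in> states M'" "c \<in> insert None (Some ` input_alphabet M')" "Z \<in> stack_alphabet M'"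
      "transition M' q c Z = Some (p, \<beta>)" for q c Z p \<beta>
  proof -
    from that(1,3) obtain q' Z'
      where *: "q = f q'" "q' \<in> states M" "Z = g Z'" "Z' \<in> stack_alphabet M"
      by (auto simp: rename_pda_def)
    with that(4) obtain p' \<beta>' where **: "transition M q' c Z' = Some (p', \<beta>')" "p = f p'" "\<beta> = map g \<beta>'"
      by (auto simp: transition_renamed)
    from that(2) have "c \<in> insert None (Some ` input_alphabet M)" by (simp add: rename_pda_def)
    with dpda_transition_closed[OF dpda **(1)] * have
      "p' \<in> states M" "\<beta>' \<in> lists (stack_alphabet M)" by simp_all
    with ** show ?thesis by (auto simp: rename_pda_def)
  qed
  have deterministic: "transition M' q (Some a) Z = None"
    if "q \<in> states M'" "a \<in> input_alphabet M'" "Z \<in> stack_alphabet M'"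
      "transition M' q None Z \<noteq> None" for q a Z
  proof -
    from that(1,3) obtain q' Z'
      where *: "q = f q'" "q' \<in> states M" "Z = g Z'" "Z' \<in> stack_alphabet M"
      by (auto simp: rename_pda_def)
    moreover from * that(4) have "transition M q' None Z' \<noteq> None" by (simp add: transition_renamed)
    moreover from that(2) have "a \<in> input_alphabet M" by (simp add: rename_pda_def)
    ultimately have "transition M q' (Some a) Z' = None" using dpda_deterministic[OF dpda] by simp
    with * show ?thesis by (simp add: transition_renamed)
  qed
  have "finite (states M')" "finite (input_alphabet M')" "finite (stack_alphabet M')"
    "start_state M' \<in> states M'" "start_symbol M' \<in> stack_alphabet M'"
    "final_states M' \<subseteq> states M'"
    using dpdaD[OF dpda] by (simp_all add: rename_pda_def image_mono)
  then show ?thesis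
    unfolding dpda_def by (intro conjI ballI allI impI) (use closed deterministic in \<open>blast+\<close>)
qed

text \<open>The successor \<open>c\<close> is arbitrary, so no step leaves the renamed
  configurations. Runs can therefore be pushed forward and pulled back.\<close>

lemma step_renamed_iff:
  assumes "q \<in> states M" "\<gamma> \<in> lists (stack_alphabet M)"
  shows "pda_step M' (f q, w, map g \<gamma>) c \<longleftrightarrow>
    (\<exists>q' w' \<gamma>'. c = (f q', w', map g \<gamma>') \<and> pda_step M (q, w, \<gamma>) (q', w', \<gamma>'))"
proof
  assume "pda_step M' (f q, w, map g \<gamma>) c"
  then show "\<exists>q' w' \<gamma>'. c = (f q', w', map g \<gamma>') \<and> pda_step M (q, w, \<gamma>) (q', w', \<gamma>')"
  proof cases
    case (read a Z p \<beta> w1 \<gamma>1)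
    then obtain Z0 \<gamma>0 where \<gamma>: "\<gamma> = Z0 # \<gamma>0" "Z = g Z0" "\<gamma>1 = map g \<gamma>0" by auto
    with read assms obtain p' \<beta>' where
      "transition M q (Some a) Z0 = Some (p', \<beta>')" "p = f p'" "\<beta> = map g \<beta>'"
      by (auto simp: transition_renamed)
    with read \<gamma> show ?thesis
      by (intro exI[of _ p'] exI[of _ w1] exI[of _ "\<beta>' @ \<gamma>0"]) (auto intro: pda_step.read)
  next
    case (silent Z p \<beta> \<gamma>1)
    then obtain Z0 \<gamma>0 where \<gamma>: "\<gamma> = Z0 # \<gamma>0" "Z = g Z0" "\<gamma>1 = map g \<gamma>0" by auto
    with silent assms obtain p' \<beta>' where
      "transition M q None Z0 = Some (p', \<beta>')" "p = f p'" "\<beta> = map g \<beta>'"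
      by (auto simp: transition_renamed)
    with silent \<gamma> show ?thesis
      by (intro exI[of _ p'] exI[of _ w] exI[of _ "\<beta>' @ \<gamma>0"]) (auto intro: pda_step.silent)
  qed
next
  assume "\<exists>q' w' \<gamma>'. c = (f q', w', map g \<gamma>') \<and> pda_step M (q, w, \<gamma>) (q', w', \<gamma>')"
  then obtain q' w' \<gamma>' where c: "c = (f q', w', map g \<gamma>')"
    and "pda_step M (q, w, \<gamma>) (q', w', \<gamma>')" by blast
  from this(2) show "pda_step M' (f q, w, map g \<gamma>) c"
    unfolding c using assms
    by cases (auto intro!: pda_step.intros simp: transition_renamed)
qed

lemma steps_renamed:
  assumes "(pda_step M)\<^sup>*\<^sup>* (q, w, \<gamma>) (q', w', \<gamma>')"
    "q \<in> states M" "w \<in> lists (input_alphabet M)" "\<gamma> \<in> lists (stack_alphabet M)"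
  shows "(pda_step M')\<^sup>*\<^sup>* (f q, w, map g \<gamma>) (f q', w', map g \<gamma>')"
  using assms
proof (induction rule: converse_rtranclp_induct3)
  case refl
  then show ?case by simp
next
  case (step q w \<gamma> q1 w1 \<gamma>1)
  have "pda_step M' (f q, w, map g \<gamma>) (f q1, w1, map g \<gamma>1)"
    using step by (auto simp: step_renamed_iff)
  also have "(pda_step M')\<^sup>*\<^sup>* (f q1, w1, map g \<gamma>1) (f q', w', map g \<gamma>')"
    using dpda_step_closed[OF dpda step.hyps(1) step.prems] by (rule step.IH)
  finally show ?case .
qed

lemma steps_of_renamed:
  assumes "(pda_step M')\<^sup>*\<^sup>* (f q, w, map g \<gamma>) c"
    "q \<in> states M" "w \<in> lists (input_alphabet M)" "\<gamma> \<in> lists (stack_alphabet M)"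
  shows "\<exists>q' w' \<gamma>'. c = (f q', w', map g \<gamma>') \<and> q' \<in> states M \<and> w' \<in> lists (input_alphabet M) \<and>
    \<gamma>' \<in> lists (stack_alphabet M) \<and> (pda_step M)\<^sup>*\<^sup>* (q, w, \<gamma>) (q', w', \<gamma>')"
  using assms(1)
proof (induction rule: rtranclp_induct)
  case base
  with assms show ?case by blast
next
  case (step c c')
  then obtain q1 w1 \<gamma>1 where *: "c = (f q1, w1, map g \<gamma>1)" "q1 \<in> states M"
    "w1 \<in> lists (input_alphabet M)" "\<gamma>1 \<in> lists (stack_alphabet M)"
    "(pda_step M)\<^sup>*\<^sup>* (q, w, \<gamma>) (q1, w1, \<gamma>1)" by blast
  with step obtain q2 w2 \<gamma>2 where **: "c' = (f q2, w2, map g \<gamma>2)"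
    "pda_step M (q1, w1, \<gamma>1) (q2, w2, \<gamma>2)" by (auto simp: step_renamed_iff)
  have "(pda_step M)\<^sup>*\<^sup>* (q, w, \<gamma>) (q2, w2, \<gamma>2)"
    using *(5) **(2) by (rule rtranclp.rtrancl_into_rtrancl)
  with **(1) dpda_step_closed[OF dpda **(2) *(2-4)] show ?case by blast
qed

lemma accepted_language_renamed: "accepted_language M' = accepted_language M"
proof -
  have start: "start_state M \<in> states M" "[start_symbol M] \<in> lists (stack_alphabet M)"
    and fin: "final_states M \<subseteq> states M"
    using dpdaD[OF dpda] by simp_all
  have acceptance: "(\<exists>p \<in> final_states M'. \<exists>\<gamma>.
      (pda_step M')\<^sup>*\<^sup>* (start_state M', w, [start_symbol M']) (p, [], \<gamma>)) \<longleftrightarrow>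
    (\<exists>q \<in> final_states M. \<exists>\<gamma>. (pda_step M)\<^sup>*\<^sup>* (start_state M, w, [start_symbol M]) (q, [], \<gamma>))"
    (is "?L w \<longleftrightarrow> ?R w") if w: "w \<in> lists (input_alphabet M)" for w
  proof
    assume "?L w"
    then obtain q \<gamma> where q: "q \<in> final_states M"
      "(pda_step M')\<^sup>*\<^sup>* (f (start_state M), w, map g [start_symbol M]) (f q, [], \<gamma>)"
      by (auto simp: rename_pda_def)
    from steps_of_renamed[OF q(2) start(1) w start(2)] obtain q' \<gamma>' where
      "f q = f q'" "q' \<in> states M"
      "(pda_step M)\<^sup>*\<^sup>* (start_state M, w, [start_symbol M]) (q', [], \<gamma>')" by blast
    \<comment> \<open>The pulled-back run ends in a state that only has the same image as a final
      state; injectivity identifies the two.\<close>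
    moreover from this have "q' = q" using q(1) fin inj_f by (auto dest: inj_onD)
    ultimately show "?R w" using q(1) by blast
  next
    assume "?R w"
    then obtain q \<gamma> where q: "q \<in> final_states M"
      "(pda_step M)\<^sup>*\<^sup>* (start_state M, w, [start_symbol M]) (q, [], \<gamma>)" by blast
    from steps_renamed[OF q(2) start(1) w start(2)] q(1) show "?L w" by (auto simp: rename_pda_def)
  qed
  have alphabet: "input_alphabet M' = input_alphabet M" by (simp add: rename_pda_def)
  show ?thesis unfolding accepted_language_def alphabet
    by (intro Collect_cong conj_cong refl acceptance)
qed

end

text \<open>Finite sets inject into the naturals, so an automaton over arbitrary types may be used
  in place of one over \<open>nat\<close>.\<close>

lemma deterministic_context_freeI:
  fixes M :: "('q, 'a, 'z) pda"
  assumes "dpda M"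
  shows "deterministic_context_free (input_alphabet M) (accepted_language M)"
proof -
  from dpdaD(1,3)[OF assms] obtain f :: "'q \<Rightarrow> nat" and g :: "'z \<Rightarrow> nat"
    where "inj_on f (states M)" "inj_on g (stack_alphabet M)"
    using finite_imp_inj_to_nat_seg by meson
  with assms interpret renamed_dpda M f g by unfold_locales
  show ?thesis unfolding deterministic_context_free_def
    by (intro exI[of _ M'])
      (auto simp: dpda_renamed accepted_language_renamed, simp_all add: rename_pda_def)
qed

section \<open>Regular tree languages in Polish notation\<close>

text \<open>This is the run of a deterministic bottom-up tree automaton with transition function
  \<open>\<delta>\<close>.\<close>

fun eval :: "('a \<Rightarrow> 'q list \<Rightarrow> 'q) \<Rightarrow> 'a ltree \<Rightarrow> 'q" where
  "eval \<delta> (Node a ts) = \<delta> a (map (eval \<delta>) ts)"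

text \<open>\<open>Returning\<close> carries the value of a subtree just completed, which has still
  to reach the frame below. \<open>Accepting\<close> is entered once the value of the whole tree
  reaches \<open>Bottom\<close>.\<close>

datatype 'q mode = Reading | Returning 'q | Accepting

datatype ('a, 'q) frame = Bottom | Frame 'a "'q list"

locale tree_automaton =
  fixes X :: "nat \<Rightarrow> 'a set" and d :: nat
    and \<delta> :: "'a \<Rightarrow> 'q list \<Rightarrow> 'q" and Q F :: "'q set"
  assumes finite_labels: "finite (\<Union>i\<le>d. X i)"
    and disjoint_labels: "disjoint_family_on X {..d}"
    and finite_Q: "finite Q"
    and \<delta>_closed: "\<And>a qs. set qs \<subseteq> Q \<Longrightarrow> \<delta> a qs \<in> Q"
begin

section \<open>Labels and their arities\<close>

definition labels :: "'a set" where
  "labels = (\<Union>i\<le>d. X i)"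

text \<open>Polish words carry no brackets: this number alone tells when a frame is complete.
  Disjointness of the \<open>X i\<close> makes the description unique on
  \<open>labels\<close>.\<close>

definition arity :: "'a \<Rightarrow> nat" where
  "arity a = (THE i. i \<le> d \<and> a \<in> X i)"

lemma arity_eq: "i \<le> d \<Longrightarrow> a \<in> X i \<Longrightarrow> arity a = i"
  unfolding arity_def using disjoint_labels
  by (intro the_equality) (auto simp: disjoint_family_on_def)

lemma arity_labels:
  assumes "a \<in> labels"
  shows "arity a \<le> d" "a \<in> X (arity a)"
  using assms arity_eq by (auto simp: labels_def)

lemma Node_in_trees:
  "a \<in> labels \<Longrightarrow> length ts = arity a \<Longrightarrow> set ts \<subseteq> trees X d \<Longrightarrow> Node a ts \<in> trees X d"
  by (rule trees.intros) (auto simp: arity_labels)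

lemma polish_in_lists_labels: "T \<in> trees X d \<Longrightarrow> polish T \<in> lists labels"
  by (induction rule: trees.induct) (fastforce simp: labels_def)

text \<open>In mode \<open>Reading\<close> a frame with too few values allows only a read and a full
  one only the silent pop, which gives determinism. Acceptance pops \<open>Bottom\<close>; the stack
  is then empty, so nothing can be read after the first complete tree.\<close>

fun move :: "'q mode \<Rightarrow> 'a option \<Rightarrow> ('a, 'q) frame \<Rightarrow> ('q mode \<times> ('a, 'q) frame list) option" where
  "move Reading (Some a) Bottom =
     (if a \<in> labels then Some (Reading, [Frame a [], Bottom]) else None)"
| "move Reading (Some a) (Frame b qs) =
     (if a \<in> labels \<and> length qs < arity b then Some (Reading, [Frame a [], Frame b qs]) else None)"
| "move Reading None (Frame b qs) =
     (if length qs = arity b then Some (Returning (\<delta> b qs), []) else None)"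
| "move (Returning q) None (Frame b qs) =
     (if length qs < arity b then Some (Reading, [Frame b (qs @ [q])]) else None)"
| "move (Returning q) None Bottom = (if q \<in> F then Some (Accepting, []) else None)"
| "move _ _ _ = None"

text \<open>Bounding the number of stored values by the arity keeps the stack alphabet
  finite.\<close>

definition frames :: "('a, 'q) frame set" where
  "frames = insert Bottom
     ((\<lambda>(a, qs). Frame a qs) ` {(a, qs). a \<in> labels \<and> set qs \<subseteq> Q \<and> length qs \<le> arity a})"

lemma in_frames [simp]:
  "Bottom \<in> frames"
  "Frame a qs \<in> frames \<longleftrightarrow> a \<in> labels \<and> set qs \<subseteq> Q \<and> length qs \<le> arity a"
  by (auto simp: frames_def)

definition polish_pda :: "('q mode, 'a, ('a, 'q) frame) pda" where
  "polish_pda =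
     \<lparr>states = {Reading, Accepting} \<union> Returning ` Q, input_alphabet = labels,
      stack_alphabet = frames, transition = move, start_state = Reading, start_symbol = Bottom,
      final_states = {Accepting}\<rparr>"

lemma finite_frames: "finite frames"
proof -
  have "finite (labels \<times> {qs. set qs \<subseteq> Q \<and> length qs \<le> d})"
    using finite_labels finite_Q by (simp add: labels_def finite_lists_length_le)
  then have "finite {(a, qs). a \<in> labels \<and> set qs \<subseteq> Q \<and> length qs \<le> arity a}"
    by (rule rev_finite_subset) (use arity_labels in \<open>force\<close>)
  then show ?thesis by (simp add: frames_def)
qed

lemma move_closed:
  assumes "move q c Z = Some (p, \<beta>)" "q \<in> {Reading, Accepting} \<union> Returning ` Q" "Z \<in> frames"
  shows "p \<in> {Reading, Accepting} \<union> Returning ` Q \<and> \<beta> \<in> lists frames"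
  using assms
  by (induction q c Z rule: move.induct)
    (auto simp: \<delta>_closed split: if_splits)

lemma move_deterministic: "move q None Z \<noteq> None \<Longrightarrow> move q (Some a) Z = None"
  by (cases q; cases Z) (auto split: if_splits)

lemma dpda_polish_pda: "dpda polish_pda"
  unfolding dpda_def polish_pda_def pda.simps
proof (intro conjI ballI allI impI)
  show "finite labels" using finite_labels by (simp add: labels_def)
qed (use finite_frames finite_Q move_closed move_deterministic in \<open>auto simp del: in_lists_conv_set\<close>)

section \<open>Completeness: the run on the Polish word of a tree\<close>

abbreviation steps where
  "steps \<equiv> (pda_step polish_pda)\<^sup>*\<^sup>*"

lemma read_step:
  "move q (Some a) Z = Some (p, \<beta>) \<Longrightarrow> steps (q, a # w, Z # \<gamma>) (p, w, \<beta> @ \<gamma>)"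
  by (intro r_into_rtranclp pda_step.read) (simp add: polish_pda_def)

lemma silent_step:
  "move q None Z = Some (p, \<beta>) \<Longrightarrow> steps (q, w, Z # \<gamma>) (p, w, \<beta> @ \<gamma>)"
  by (intro r_into_rtranclp pda_step.silent) (simp add: polish_pda_def)

text \<open>These are the frames on which the reading of a subtree may start; \<open>Bottom\<close>
  belongs to them because it awaits the whole tree.\<close>

fun incomplete :: "('a, 'q) frame \<Rightarrow> bool" where
  "incomplete Bottom = True"
| "incomplete (Frame a qs) \<longleftrightarrow> length qs < arity a"

text \<open>Rest input, top frame and lower stack are arbitrary, so that the induction hypothesis
  applies to each child on top of its parent's frame.\<close>

lemma polish_run:
  "T \<in> trees X d \<Longrightarrow> incomplete Z \<Longrightarrow>
   steps (Reading, polish T @ w, Z # \<gamma>) (Returning (eval \<delta> T), w, Z # \<gamma>)"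
proof (induction T arbitrary: w Z \<gamma>)
  case (Node a ts)
  from Node.prems(1) have ts: "length ts \<le> d" "a \<in> X (length ts)" "set ts \<subseteq> trees X d"
    by (cases; auto)+
  then have a: "a \<in> labels" "length ts = arity a" using arity_eq by (auto simp: labels_def)
  \<comment> \<open>Here \<open>us\<close> are the children still to be read and \<open>qs\<close>
    the values already stored. The equation on lengths makes the frame incomplete as long as
    \<open>us\<close> is nonempty.\<close>
  have children: "steps (Reading, concat (map polish us) @ w, Frame a qs # \<gamma>)
      (Reading, w, Frame a (qs @ map (eval \<delta>) us) # \<gamma>)"
    if "set us \<subseteq> set ts" "length qs + length us = arity a" for us qs \<gamma>
    using that
  proof (induction us arbitrary: qs)
    case (Cons u us)
    have "steps (Reading, polish u @ concat (map polish us) @ w, Frame a qs # \<gamma>)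
        (Returning (eval \<delta> u), concat (map polish us) @ w, Frame a qs # \<gamma>)"
      using Cons.prems ts by (intro Node.IH) auto
    also have "steps \<dots> (Reading, concat (map polish us) @ w, Frame a (qs @ [eval \<delta> u]) # \<gamma>)"
      using Cons.prems silent_step[where \<beta> = "[Frame a (qs @ [eval \<delta> u])]"] by simp
    also have "steps \<dots> (Reading, w, Frame a (qs @ map (eval \<delta>) (u # us)) # \<gamma>)"
      using Cons.prems Cons.IH[of "qs @ [eval \<delta> u]"] by simp
    finally show ?case by simp
  qed simp
  have "move Reading (Some a) Z = Some (Reading, [Frame a [], Z])"
    using Node.prems(2) a(1) by (cases Z) auto
  from read_step[OF this] have "steps (Reading, polish (Node a ts) @ w, Z # \<gamma>)
      (Reading, concat (map polish ts) @ w, Frame a [] # Z # \<gamma>)" by simp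
  also have "steps \<dots> (Reading, w, Frame a (map (eval \<delta>) ts) # Z # \<gamma>)"
    using children[of ts "[]"] a by simp
  also have "steps \<dots> (Returning (eval \<delta> (Node a ts)), w, Z # \<gamma>)"
    using a silent_step[where \<beta> = "[]"] by simp
  finally show ?case .
qed

text \<open>\<open>unread u \<gamma>\<close>: the frames \<open>\<gamma>\<close> describe the spine of a tree of which only the initial
  segment \<open>u\<close> of its Polish notation has been read.\<close>

inductive unread :: "'a list \<Rightarrow> ('a, 'q) frame list \<Rightarrow> bool" where
  bottom: "unread [] [Bottom]"
| frame: "unread u \<gamma> \<Longrightarrow> a \<in> labels \<Longrightarrow> set ts \<subseteq> trees X d \<Longrightarrow> qs = map (eval \<delta>) ts \<Longrightarrow>
    unread (u @ a # concat (map polish ts)) (Frame a qs # \<gamma>)"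

text \<open>Soundness rests on recovering the input read so far from mode and stack. While a value
  is being returned, that input ends in the word of a complete subtree not yet recorded on the
  stack.\<close>

fun invariant :: "'a list \<Rightarrow> 'q mode \<Rightarrow> ('a, 'q) frame list \<Rightarrow> bool" where
  "invariant u Reading \<gamma> \<longleftrightarrow> unread u \<gamma>"
| "invariant u (Returning q) \<gamma> \<longleftrightarrow>
     (\<exists>v T. u = v @ polish T \<and> T \<in> trees X d \<and> eval \<delta> T = q \<and> unread v \<gamma>)"
| "invariant u Accepting \<gamma> \<longleftrightarrow> u \<in> polish ` {T \<in> trees X d. eval \<delta> T \<in> F}"

lemma unread_push: "unread u \<gamma> \<Longrightarrow> a \<in> labels \<Longrightarrow> unread (u @ [a]) (Frame a [] # \<gamma>)"
  using unread.frame[of u \<gamma> a "[]" "[]"] by simp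

lemma invariant_read:
  assumes "invariant u q (Z # \<gamma>)" "move q (Some a) Z = Some (p, \<beta>)"
  shows "invariant (u @ [a]) p (\<beta> @ \<gamma>)"
  using assms by (cases q; cases Z) (auto split: if_splits intro: unread_push)

text \<open>Popping a full frame assembles its label and children into a tree; handing over a value
  appends that tree to the children of the frame below; at \<open>Bottom\<close> the tree accounts
  for all the input read.\<close>

lemma invariant_silent:
  assumes "invariant u q (Z # \<gamma>)" "move q None Z = Some (p, \<beta>)"
  shows "invariant u p (\<beta> @ \<gamma>)"
proof (cases q)
  case Reading
  with assms obtain b qs where Z: "Z = Frame b qs" "length qs = arity b" "p = Returning (\<delta> b qs)"
    "\<beta> = []" by (cases Z) (auto split: if_splits)
  with assms Reading have "unread u (Frame b qs # \<gamma>)" by simp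
  then obtain v ts where v: "u = v @ polish (Node b ts)" "unread v \<gamma>" "b \<in> labels"
    "set ts \<subseteq> trees X d" "qs = map (eval \<delta>) ts" by cases auto
  \<comment> \<open>The pop requires \<open>length qs = arity b\<close>, which is what makes
    \<open>Node b ts\<close> well formed.\<close>
  moreover from this Z have "Node b ts \<in> trees X d" by (intro Node_in_trees) auto
  ultimately show ?thesis using Z by (auto intro!: exI[of _ v] exI[of _ "Node b ts"])
next
  case (Returning r)
  with assms obtain v T where v: "u = v @ polish T" "T \<in> trees X d" "eval \<delta> T = r"
    "unread v (Z # \<gamma>)" by auto
  show ?thesis
  proof (cases Z)
    case Bottom
    \<comment> \<open>\<open>Bottom\<close> occurs on top only in the base case of
      \<open>unread\<close>, so nothing precedes the word of \<open>T\<close>.\<close>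
    with v(4) have "v = []" by (auto elim: unread.cases)
    with v have "u = polish T" by simp
    with v assms(2) Returning Bottom show ?thesis by (auto split: if_splits)
  next
    case (Frame b qs)
    with v(4) obtain v' ts where v': "v = v' @ b # concat (map polish ts)" "unread v' \<gamma>" "b \<in> labels"
      "set ts \<subseteq> trees X d" "qs = map (eval \<delta>) ts" by cases auto
    with v have "unread (v' @ b # concat (map polish (ts @ [T]))) (Frame b (qs @ [r]) # \<gamma>)"
      by (intro unread.frame) auto
    with v v' assms Returning Frame show ?thesis by (auto split: if_splits)
  qed
next
  case Accepting
  with assms show ?thesis by simp
qed

lemma invariant_steps:
  assumes "steps (Reading, w, [Bottom]) (q, w', \<gamma>)"
  shows "\<exists>u. w = u @ w' \<and> invariant u q \<gamma>"
  using assms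
proof (induction rule: rtranclp_induct3)
  case refl
  show ?case by (auto intro: unread.bottom)
next
  case (step q w1 \<gamma> q' w2 \<gamma>')
  then obtain u where u: "w = u @ w1" "invariant u q \<gamma>" by blast
  from step.hyps(2) show ?case
  proof cases
    case (read a Z \<beta> \<gamma>1)
    with u invariant_read[of u q Z \<gamma>1 a q' \<beta>] show ?thesis
      by (intro exI[of _ "u @ [a]"]) (auto simp: polish_pda_def)
  next
    case (silent Z \<beta> \<gamma>1)
    with u invariant_silent[of u q Z \<gamma>1 q' \<beta>] show ?thesis
      by (intro exI[of _ u]) (auto simp: polish_pda_def)
  qed
qed

lemma accepted_language_polish_pda:
  "accepted_language polish_pda = polish ` {T \<in> trees X d. eval \<delta> T \<in> F}"
proof (intro equalityI subsetI)
  fix w assume "w \<in> accepted_language polish_pda"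
  then obtain \<gamma> where "steps (Reading, w, [Bottom]) (Accepting, [], \<gamma>)"
    by (auto simp: accepted_language_def polish_pda_def)
  from invariant_steps[OF this] show "w \<in> polish ` {T \<in> trees X d. eval \<delta> T \<in> F}" by simp
next
  fix w assume "w \<in> polish ` {T \<in> trees X d. eval \<delta> T \<in> F}"
  then obtain T where T: "w = polish T" "T \<in> trees X d" "eval \<delta> T \<in> F" by auto
  from T have "steps (Reading, w, [Bottom]) (Returning (eval \<delta> T), [], [Bottom])"
    using polish_run[of T Bottom "[]" "[]"] by simp
  also have "steps \<dots> (Accepting, [], [])"
    using T silent_step[where \<beta> = "[]"] by simp
  finally show "w \<in> accepted_language polish_pda"
    using T polish_in_lists_labels by (auto simp: accepted_language_def polish_pda_def)
qed

theorem deterministic_context_free_regular_trees: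
  "deterministic_context_free (\<Union>i\<le>d. X i) (polish ` {T \<in> trees X d. eval \<delta> T \<in> F})"
  using deterministic_context_freeI[OF dpda_polish_pda]
  unfolding accepted_language_polish_pda by (simp add: polish_pda_def labels_def)

end

section \<open>Regularity of pattern avoidance\<close>

fun subtrees :: "'a ltree \<Rightarrow> 'a ltree set" where
  "subtrees (Node a ts) = insert (Node a ts) (\<Union>t \<in> set ts. subtrees t)"

lemma finite_subtrees: "finite (subtrees t)"
  by (induction t) auto

lemma subtrees_refl: "t \<in> subtrees t"
  by (cases t) simp

text \<open>Supplies the closure under children that the bottom-up computation of matches relies
  on.\<close>

lemma subtrees_children: "Node a ts \<in> subtrees t \<Longrightarrow> set ts \<subseteq> subtrees t"
  by (induction t) (use subtrees_refl in fastforce)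

lemma matches_Node_iff:
  "matches x p (Node a ts) \<longleftrightarrow>
     p = Node x [] \<or> (\<exists>ps. p = Node a ps \<and> list_all2 (matches x) ps ts)"
  by (subst matches.simps) auto

lemma occurs_Node_iff:
  "occurs x p (Node a ts) \<longleftrightarrow> matches x p (Node a ts) \<or> (\<exists>t \<in> set ts. occurs x p t)"
  by (subst occurs.simps) auto

text \<open>\<open>Ss\<close> is meant to list, child by child, the members of \<open>P\<close>
  matching there. A free end matches every tree, whatever \<open>Ss\<close> is.\<close>

definition matching_step ::
    "'a \<Rightarrow> 'a ltree set \<Rightarrow> 'a \<Rightarrow> 'a ltree set list \<Rightarrow> 'a ltree set" where
  "matching_step x P a Ss =
     {p \<in> P. p = Node x [] \<or> (\<exists>ps. p = Node a ps \<and> list_all2 (\<in>) ps Ss)}"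

text \<open>The Boolean is a sticky flag: once a pattern of \<open>Y\<close> has matched at a
  vertex, it stays raised at all ancestors.\<close>

definition occurrence_step ::
    "'a \<Rightarrow> 'a ltree set \<Rightarrow> 'a ltree set \<Rightarrow> 'a \<Rightarrow> ('a ltree set \<times> bool) list \<Rightarrow> 'a ltree set \<times> bool" where
  "occurrence_step x P Y a qs =
     (let S = matching_step x P a (map fst qs) in (S, S \<inter> Y \<noteq> {} \<or> True \<in> snd ` set qs))"

text \<open>The children of a pattern in \<open>P\<close> lie in \<open>P\<close> again, so the sets
  computed at the children of the vertex decide whether they match.\<close>

lemma matching_step_matches:
  assumes "\<And>a ps. Node a ps \<in> P \<Longrightarrow> set ps \<subseteq> P"
  shows "matching_step x P a (map (\<lambda>t. {p \<in> P. matches x p t}) ts) =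
    {p \<in> P. matches x p (Node a ts)}"
proof -
  have "list_all2 (\<in>) ps (map (\<lambda>t. {p \<in> P. matches x p t}) ts) \<longleftrightarrow> list_all2 (matches x) ps ts"
    if "Node a ps \<in> P" for ps
    using assms[OF that] by (auto simp: list_all2_conv_all_nth subset_iff)
  then show ?thesis unfolding matching_step_def matches_Node_iff by blast
qed

text \<open>An occurrence lies either at the root or inside a child. Since \<open>Y\<close> is
  contained in \<open>P\<close>, the root case is visible in the computed set of matches.\<close>

lemma eval_occurrence_step:
  assumes "\<And>a ps. Node a ps \<in> P \<Longrightarrow> set ps \<subseteq> P" and "Y \<subseteq> P"
  shows "eval (occurrence_step x P Y) T = ({p \<in> P. matches x p T}, \<exists>p \<in> Y. occurs x p T)"
proof (induction T)
  case (Node a ts)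
  let ?v = "\<lambda>T. ({p \<in> P. matches x p T}, \<exists>p \<in> Y. occurs x p T)"
  have "map (eval (occurrence_step x P Y)) ts = map ?v ts" using Node.IH by simp
  moreover have "occurrence_step x P Y a (map ?v ts) = ?v (Node a ts)"
    using \<open>Y \<subseteq> P\<close>
    by (auto simp: occurrence_step_def Let_def comp_def matching_step_matches[OF assms(1)]
        occurs_Node_iff)
  ultimately show ?case unfolding eval.simps by (rule ssubst)
qed

theorem theorem4p1:
  fixes X :: "nat \<Rightarrow> 'a set" and d :: nat and x :: 'a and Y :: "'a ltree set"
  assumes "d > 0"
    and "finite (\<Union>i\<le>d. X i)"
    and "disjoint_family_on X {..d}"
    and "X 0 = {x}"
    and "finite Y"
    and "Y \<subseteq> trees X d"
  shows "deterministic_context_free (\<Union>i\<le>d. X i) (avoiding_language X d x Y)"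
proof -
  \<comment> \<open>Closing \<open>Y\<close> under subtrees keeps it finite and makes it closed
    under children.\<close>
  define P where "P = (\<Union>p \<in> Y. subtrees p)"
  define \<delta> where "\<delta> = occurrence_step x P Y"
  have "finite P" using \<open>finite Y\<close> by (simp add: P_def finite_subtrees)
  \<comment> \<open>Values pair a subset of \<open>P\<close> with the flag, hence are finitely many;
    a tree is accepted when the flag is down.\<close>
  then interpret tree_automaton X d \<delta> "Pow P \<times> UNIV" "UNIV \<times> {False}"
    using assms(2,3)
    by unfold_locales (auto simp: \<delta>_def occurrence_step_def matching_step_def Let_def)
  have "eval \<delta> T = ({p \<in> P. matches x p T}, \<exists>p \<in> Y. occurs x p T)" for T
    unfolding \<delta>_def
    by (rule eval_occurrence_step) (use subtrees_children subtrees_refl in \<open>fastforce simp: P_def\<close>)+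
  \<comment> \<open>\<open>X 0 = {x}\<close> provides the free end at which a tree is cut to turn an
    occurrence into a grafting.\<close>
  then have "avoiding_language X d x Y = polish ` {T \<in> trees X d. eval \<delta> T \<in> UNIV \<times> {False}}"
    using assms(4,6) by (auto simp: avoiding_language_def avoids_iff_no_occurrence)
  then show ?thesis using deterministic_context_free_regular_trees by simp
qed

end
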